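(* Let $n\ge 2$ and $\varphi\in\Phi_2$. The operation $+_\varphi:\left(\mathcal{K}^n_s\right)^2\to\mathcal{K}^n_s$ is commutative (i.e. $K+_\varphi L=L+_\varphi K$ for all $K,L\in\mathcal{K}^n_s$) if and only if it can be defined as an Orlicz addition, i.e. coincides on $\left(\mathcal{K}^n_s\right)^2$ with $+_\psi$, for some $\psi\in\Phi_2$ that is either $\psi(x_1,x_2)=\max\{x_1,x_2\}$ or of the form $\psi(x_1,x_2)=\varphi_0(x_1)+\varphi_0(x_2)$ with $\varphi_0\in\Phi$. The same equivalence holds with $\mathcal{K}^n_s$ replaced by $\mathcal{K}^n_o$ throughout.
   Context: $\mathcal{K}^n_o$ is the class of compact convex subsets of $\mathbb{R}^n$ containing the origin $o$; $\mathcal{K}^n_s$ is the class of nonempty compact convex sets $K$ in $\mathbb{R}^n$ with $K=-K$. The support function of $K$ is $h_K(x)=\sup\{x\cdot y:y\in K\}$. $\Phi_m$ is the set of convex functions $\varphi:[0,\infty)^m\to[0,\infty)$ that are increasing (i.e. nondecreasing) in each variable and satisfy $\varphi(o)=0$ and $\varphi(e_j)=1$, $j=1,\dots,m$, where $e_1,\dots,e_m$ is the standard basis; $\Phi=\Phi_1$. For $\varphi\in\Phi_2$ and $K,L\in\mathcal{K}^n_o$, the Orlicz sum $K+_\varphi L$ is the compact convex set with support function $$h_{K+_\varphi L}(x)=\inf\left\{\lambda>0:\varphi\left(\frac{h_{K}(x)}{\lambda},\frac{h_{L}(x)}{\lambda}\right)\le 1\right\},\quad x\in\mathbb{R}^n;$$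 it belongs to $\mathcal{K}^n_o$, and to $\mathcal{K}^n_s$ if $K,L\in\mathcal{K}^n_s$. *)

theory Defs
  imports "HOL-Analysis.Analysis"
begin

definition compact_convex_with_origin :: "(real ^ 'n) set set" where
  "compact_convex_with_origin = {K. compact K \<and> convex K \<and> 0 \<in> K}"

definition compact_convex_symmetric :: "(real ^ 'n) set set" where
  "compact_convex_symmetric = {K. compact K \<and> convex K \<and> K \<noteq> {} \<and> K = uminus ` K}"

text \<open>The value is the usual one for nonempty bounded sets; the real-valued supremum of the
  empty set is unspecified.\<close>

definition support_function :: "(real ^ 'n) set \<Rightarrow> real ^ 'n \<Rightarrow> real" where
  "support_function K x = (SUP y\<in>K. x \<bullet> y)"

definition nonneg_orthant :: "(real ^ 'm) set" where
  "nonneg_orthant = {x. \<forall>i. 0 \<le> x $ i}"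

text \<open>Functions on the orthant are represented by total functions on the whole space, of which
  only the restriction to the orthant is constrained. Consequently, members of the class are to
  be compared on the orthant only.\<close>

definition Orlicz_class :: "(real ^ 'm \<Rightarrow> real) set" where
  "Orlicz_class = {\<phi>.
     convex_on nonneg_orthant \<phi> \<and>
     (\<forall>x\<in>nonneg_orthant. 0 \<le> \<phi> x) \<and>
     (\<forall>x\<in>nonneg_orthant. \<forall>j t. x $ j \<le> t \<longrightarrow> \<phi> x \<le> \<phi> (\<chi> i. if i = j then t else x $ i)) \<and>
     \<phi> 0 = 0 \<and>
     (\<forall>j. \<phi> (axis j 1) = 1)}"

text \<open>The one-variable class, with the half-line in \<open>real\<close> identified with the orthant in
  \<open>real ^ 1\<close>.\<close>

definition Orlicz_class_1 :: "(real \<Rightarrow> real) set" where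
  "Orlicz_class_1 = {\<phi>. (\<lambda>x :: real ^ 1. \<phi> (x $ 1)) \<in> Orlicz_class}"

definition Orlicz_sum_support ::
    "(real ^ 2 \<Rightarrow> real) \<Rightarrow> (real ^ 'n) set \<Rightarrow> (real ^ 'n) set \<Rightarrow> real ^ 'n \<Rightarrow> real" where
  "Orlicz_sum_support \<phi> K L x =
     Inf {\<mu>. 0 < \<mu> \<and>
       \<phi> (vector [support_function K x / \<mu>, support_function L x / \<mu>]) \<le> 1}"

definition Orlicz_sum ::
    "(real ^ 2 \<Rightarrow> real) \<Rightarrow> (real ^ 'n) set \<Rightarrow> (real ^ 'n) set \<Rightarrow> (real ^ 'n) set" where
  "Orlicz_sum \<phi> K L =
     (THE M. compact M \<and> convex M \<and> M \<noteq> {} \<and>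
       (\<forall>x. support_function M x = Orlicz_sum_support \<phi> K L x))"

definition commutative_op_on :: "'a set \<Rightarrow> ('a \<Rightarrow> 'a \<Rightarrow> 'a) \<Rightarrow> bool" where
  "commutative_op_on C f \<longleftrightarrow> (\<forall>K\<in>C. \<forall>L\<in>C. f K L = f L K)"

text \<open>Either the maximum or a sum of two copies of one function of the class in one variable.\<close>

definition max_or_equal_sum :: "(real ^ 2 \<Rightarrow> real) \<Rightarrow> bool" where
  "max_or_equal_sum \<psi> \<longleftrightarrow>
     (\<forall>x\<in>nonneg_orthant. \<psi> x = max (x $ 1) (x $ 2)) \<or>
     (\<exists>\<phi>\<^sub>0\<in>Orlicz_class_1. \<forall>x\<in>nonneg_orthant. \<psi> x = \<phi>\<^sub>0 (x $ 1) + \<phi>\<^sub>0 (x $ 2))"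

end

theory Submission
  imports Defs
begin

text \<open>The Orlicz sum depends on \<open>\<phi>\<close> only through the gauge \<open>g\<close> of the set \<open>{\<phi> \<le> 1}\<close>, and evaluating
  it on balls shows that it is commutative iff \<open>g\<close> is symmetric. Suppose so, and let \<open>(t, t)\<close> be the
  point with \<open>g = 1\<close> on the diagonal. If \<open>t = 1\<close>, then \<open>g\<close> is the maximum. Otherwise let \<open>y = f x\<close>
  describe the curve \<open>g = 1\<close> over \<open>[0, t]\<close>. A function \<open>\<phi>\<^sub>0\<close> such that \<open>{\<phi>\<^sub>0 + \<phi>\<^sub>0 \<le> 1}\<close> is the unit
  set of \<open>g\<close> can be chosen proportional to \<open>1 - f\<close> on \<open>[0, t]\<close>; the condition \<open>\<phi>\<^sub>0 (f x) = 1 - \<phi>\<^sub>0 x\<close>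
  then forces it to be affine on \<open>[t, 1]\<close>, so that it extends to a finite convex function on
  \<open>[0, \<infinity>)\<close> even if the curve has a vertical tangent at \<open>(1, 0)\<close>.\<close>

section \<open>Support functions\<close>

lemma support_function_ge:
  assumes "compact K" "y \<in> K"
  shows "x \<bullet> y \<le> support_function K x"
  unfolding support_function_def
proof (rule cSUP_upper[OF assms(2)])
  have "compact ((\<bullet>) x ` K)"
    by (intro compact_continuous_image assms continuous_intros)
  then show "bdd_above ((\<bullet>) x ` K)"
    by (simp add: bounded_imp_bdd_above compact_imp_bounded)
qed

text \<open>A point of \<open>M\<close> outside \<open>N\<close> is strictly separated from
  \<open>N\<close> by a hyperplane with some normal \<open>a\<close>, and then the inequality fails
  in direction \<open>-a\<close>. Applied both ways, this shows that a support function determines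
  its body, which evaluates the description \<open>THE\<close> in \<open>Orlicz_sum\<close>.\<close>

lemma subset_of_support_function_le:
  fixes M N :: "(real ^ 'n) set"
  assumes "compact M" "compact N" "convex N" "N \<noteq> {}"
    and le: "\<And>x. support_function M x \<le> support_function N x"
  shows "M \<subseteq> N"
proof
  fix y assume "y \<in> M"
  show "y \<in> N"
  proof (rule ccontr)
    assume "y \<notin> N"
    then obtain a b where ab: "a \<bullet> y < b" "\<And>x. x \<in> N \<Longrightarrow> b < a \<bullet> x"
      using separating_hyperplane_closed_point[of N y] assms(2,3) compact_imp_closed by blast
    have "support_function N (-a) \<le> - b"
      unfolding support_function_def using assms(4) ab(2) by (intro cSUP_least) (auto simp: less_imp_le)
    moreover have "(-a) \<bullet> y \<le> support_function M (-a)"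
      by (rule support_function_ge) fact+
    ultimately show False
      using le[of "-a"] ab(1) by simp
  qed
qed

lemma support_function_cball:
  assumes "0 \<le> r"
  shows "support_function (cball 0 r) x = r * norm x"
proof (rule antisym)
  show "support_function (cball 0 r) x \<le> r * norm x"
    unfolding support_function_def
  proof (rule cSUP_least)
    fix y :: "real ^ 'a" assume "y \<in> cball 0 r"
    then have "norm x * norm y \<le> norm x * r"
      by (intro mult_left_mono) auto
    then show "x \<bullet> y \<le> r * norm x"
      using norm_cauchy_schwarz[of x y] by (simp add: mult.commute)
  qed (use assms in auto)
  \<comment> \<open>The Cauchy-Schwarz bound is attained at the multiple of \<open>x\<close> with
    norm \<open>r\<close>; for \<open>x = 0\<close> division by zero makes this point 0, which also
    lies in the ball.\<close>
  have "x \<bullet> ((r / norm x) *\<^sub>R x) \<le> support_function (cball 0 r) x"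
    by (rule support_function_ge) (use assms in auto)
  then show "r * norm x \<le> support_function (cball 0 r) x"
    by (cases "x = 0") (auto simp: dot_square_norm power2_eq_square)
qed

lemma support_function_nonneg:
  assumes "compact K" "0 \<in> K"
  shows "0 \<le> support_function K x"
  using support_function_ge[OF assms, of x] by simp

text \<open>The origin is the midpoint of \<open>y\<close> and \<open>- y\<close> for any point
  \<open>y\<close> of the set.\<close>

lemma compact_convex_symmetric_subset:
  "compact_convex_symmetric \<subseteq> compact_convex_with_origin"
proof
  fix K :: "(real ^ 'n) set"
  assume "K \<in> compact_convex_symmetric"
  then have K: "compact K" "convex K" "K \<noteq> {}" "K = uminus ` K"
    by (auto simp: compact_convex_symmetric_def)
  then obtain y where y: "y \<in> K" by blast
  then have "- y \<in> K" using K(4) by blast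
  then have "(1/2) *\<^sub>R y + (1/2) *\<^sub>R (- y) \<in> K"
    by (intro convexD[OF K(2) y]) auto
  then show "K \<in> compact_convex_with_origin"
    using K by (simp add: compact_convex_with_origin_def)
qed

lemma cball_in_compact_convex_symmetric:
  assumes "0 \<le> r"
  shows "cball 0 r \<in> compact_convex_symmetric"
proof -
  have "x \<in> uminus ` cball 0 r" if "x \<in> cball 0 r" for x :: "real ^ 'n"
    using that by (intro image_eqI[of _ _ "- x"]) auto
  then show ?thesis
    using assms by (auto simp: compact_convex_symmetric_def)
qed

section \<open>The gauge of an Orlicz function\<close>

text \<open>This is the Minkowski functional of \<open>{\<phi> \<le> 1}\<close> in the quadrant. It
  reduces statements about bodies to statements about two nonnegative numbers.\<close>

definition Orlicz_gauge :: "(real ^ 2 \<Rightarrow> real) \<Rightarrow> real \<Rightarrow> real \<Rightarrow> real" where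
  "Orlicz_gauge \<phi> a b = Inf {\<mu>. 0 < \<mu> \<and> \<phi> (vector [a / \<mu>, b / \<mu>]) \<le> 1}"

lemma Orlicz_sum_support_eq_gauge:
  "Orlicz_sum_support \<phi> K L x = Orlicz_gauge \<phi> (support_function K x) (support_function L x)"
  by (simp add: Orlicz_sum_support_def Orlicz_gauge_def)

text \<open>Sets containing the origin have nonnegative support functions, so only values of the
  gauge on the quadrant enter and both sums are descriptions with the same predicate.\<close>

lemma Orlicz_sum_cong:
  assumes "K \<in> compact_convex_with_origin" "L \<in> compact_convex_with_origin"
    and "\<And>a b. 0 \<le> a \<Longrightarrow> 0 \<le> b \<Longrightarrow> Orlicz_gauge \<phi> a b = Orlicz_gauge \<psi> a b"
  shows "Orlicz_sum \<phi> K L = Orlicz_sum \<psi> K L"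
  using assms unfolding Orlicz_sum_def
  by (simp add: Orlicz_sum_support_eq_gauge support_function_nonneg compact_convex_with_origin_def)

lemma Orlicz_sum_commute:
  assumes "K \<in> compact_convex_with_origin" "L \<in> compact_convex_with_origin"
    and "\<And>a b. 0 \<le> a \<Longrightarrow> 0 \<le> b \<Longrightarrow> Orlicz_gauge \<psi> a b = Orlicz_gauge \<psi> b a"
  shows "Orlicz_sum \<psi> K L = Orlicz_sum \<psi> L K"
proof -
  have "Orlicz_sum_support \<psi> K L x = Orlicz_sum_support \<psi> L K x" for x
    unfolding Orlicz_sum_support_eq_gauge
    using assms by (intro assms(3) support_function_nonneg) (auto simp: compact_convex_with_origin_def)
  then show ?thesis
    unfolding Orlicz_sum_def by simp
qed

lemma vector_2_in_nonneg_orthant [simp]: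
  "(vector [a, b] :: real ^ 2) \<in> nonneg_orthant \<longleftrightarrow> 0 \<le> a \<and> 0 \<le> b"
  by (auto simp: nonneg_orthant_def forall_2)

lemma convex_nonneg_orthant: "convex nonneg_orthant"
  by (auto simp: nonneg_orthant_def convex_def)

lemma max_or_equal_sum_gauge_commute:
  assumes "max_or_equal_sum \<psi>" "0 \<le> a" "0 \<le> b"
  shows "Orlicz_gauge \<psi> a b = Orlicz_gauge \<psi> b a"
proof -
  have "\<psi> (vector [x, y]) = \<psi> (vector [y, x])" if "0 \<le> x" "0 \<le> y" for x y
    using assms(1) that by (auto simp: max_or_equal_sum_def max.commute add.commute)
  then have "{\<mu>. 0 < \<mu> \<and> \<psi> (vector [a / \<mu>, b / \<mu>]) \<le> 1} = {\<mu>. 0 < \<mu> \<and> \<psi> (vector [b / \<mu>, a / \<mu>]) \<le> 1}"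
    using assms(2,3) by (auto simp: less_imp_le)
  then show ?thesis
    by (simp add: Orlicz_gauge_def)
qed

text \<open>These are the properties of a monotone norm restricted to the quadrant and normalised on
  the axes. The representation of a symmetric gauge argues from them and symmetry, without reference
  to \<open>\<phi>\<close>.\<close>

locale monotone_gauge =
  fixes g :: "real \<Rightarrow> real \<Rightarrow> real"
  assumes scale: "\<And>s a b. 0 < s \<Longrightarrow> 0 \<le> a \<Longrightarrow> 0 \<le> b \<Longrightarrow> g (s * a) (s * b) = s * g a b"
    and add: "\<And>a b c d. 0 \<le> a \<Longrightarrow> 0 \<le> b \<Longrightarrow> 0 \<le> c \<Longrightarrow> 0 \<le> d \<Longrightarrow> g (a + c) (b + d) \<le> g a b + g c d"
    and mono: "\<And>a b c d. 0 \<le> a \<Longrightarrow> 0 \<le> b \<Longrightarrow> a \<le> c \<Longrightarrow> b \<le> d \<Longrightarrow> g a b \<le> g c d"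
    and left: "\<And>a. 0 \<le> a \<Longrightarrow> g a 0 = a"
    and right: "\<And>b. 0 \<le> b \<Longrightarrow> g 0 b = b"

section \<open>Estimates for an Orlicz function and its gauge\<close>

context
  fixes \<phi> :: "real ^ 2 \<Rightarrow> real"
  assumes \<phi>: "\<phi> \<in> Orlicz_class"
begin

lemma Orlicz_class_mono:
  assumes "0 \<le> a" "0 \<le> b" "a \<le> c" "b \<le> d"
  shows "\<phi> (vector [a, b]) \<le> \<phi> (vector [c, d])"
proof -
  have *: "\<phi> x \<le> \<phi> (\<chi> i. if i = j then t else x $ i)" if "x \<in> nonneg_orthant" "x $ j \<le> t" for x j t
    using \<phi> that by (auto simp: Orlicz_class_def)
  have "\<phi> (vector [a, b]) \<le> \<phi> (\<chi> i. if i = 1 then c else vector [a, b] $ i)"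
    by (rule *) (use assms in auto)
  also have "(\<chi> i. if i = 1 then c else vector [a, b] $ i) = (vector [c, b] :: real ^ 2)"
    by (simp add: vec_eq_iff forall_2)
  also have "\<phi> (vector [c, b]) \<le> \<phi> (\<chi> i. if i = 2 then d else vector [c, b] $ i)"
    by (rule *) (use assms in auto)
  also have "(\<chi> i. if i = 2 then d else vector [c, b] $ i) = (vector [c, d] :: real ^ 2)"
    by (simp add: vec_eq_iff forall_2)
  finally show ?thesis .
qed

lemma Orlicz_class_convex:
  assumes "0 \<le> a" "0 \<le> b" "0 \<le> c" "0 \<le> d" "0 \<le> u" "u \<le> 1"
  shows "\<phi> (vector [(1 - u) * a + u * c, (1 - u) * b + u * d])
    \<le> (1 - u) * \<phi> (vector [a, b]) + u * \<phi> (vector [c, d])"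
proof -
  have "\<phi> ((1 - u) *\<^sub>R vector [a, b] + u *\<^sub>R vector [c, d])
      \<le> (1 - u) * \<phi> (vector [a, b]) + u * \<phi> (vector [c, d])"
    using \<phi> assms by (intro convex_onD[of nonneg_orthant]) (auto simp: Orlicz_class_def)
  also have "(1 - u) *\<^sub>R vector [a, b] + u *\<^sub>R vector [c, d]
      = (vector [(1 - u) * a + u * c, (1 - u) * b + u * d] :: real ^ 2)"
    by (simp add: vec_eq_iff forall_2)
  finally show ?thesis .
qed

lemma Orlicz_class_corners:
  "\<phi> (vector [0, 0]) = 0" "\<phi> (vector [1, 0]) = 1" "\<phi> (vector [0, 1]) = 1"
proof -
  have "vector [0, 0] = (0 :: real ^ 2)" "vector [1, 0] = (axis 1 1 :: real ^ 2)"
    "vector [0, 1] = (axis 2 1 :: real ^ 2)"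
    by (simp_all add: vec_eq_iff forall_2 axis_def)
  then show "\<phi> (vector [0, 0]) = 0" "\<phi> (vector [1, 0]) = 1" "\<phi> (vector [0, 1]) = 1"
    using \<phi> by (auto simp: Orlicz_class_def)
qed

text \<open>The unit set lies in the unit square: for \<open>a > 1\<close> the point 1 divides the
  segment from 0 to \<open>a\<close> with weight \<open>1 / a\<close>, so convexity along the axis
  gives \<phi>(a, 0) \<ge> a > 1, and monotonicity passes to (a, b).\<close>

lemma Orlicz_class_le_1_imp:
  assumes "0 \<le> a" "0 \<le> b" "\<phi> (vector [a, b]) \<le> 1"
  shows "a \<le> 1" "b \<le> 1"
proof -
  have 1: "\<phi> (vector [a, 0]) \<le> 1" "\<phi> (vector [0, b]) \<le> 1"
    using Orlicz_class_mono[of a 0 a b] Orlicz_class_mono[of 0 b a b] assms by auto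
  show "a \<le> 1"
  proof (rule ccontr)
    assume "\<not> a \<le> 1"
    then have "1 \<le> 1 / a * \<phi> (vector [a, 0])"
      using Orlicz_class_convex[of 0 0 a 0 "1 / a"] by (simp add: Orlicz_class_corners)
    also have "\<dots> \<le> 1 / a * 1"
      using 1 \<open>\<not> a \<le> 1\<close> by (intro mult_left_mono) auto
    finally show False using \<open>\<not> a \<le> 1\<close> by (simp add: field_simps)
  qed
  show "b \<le> 1"
  proof (rule ccontr)
    assume "\<not> b \<le> 1"
    then have "1 \<le> 1 / b * \<phi> (vector [0, b])"
      using Orlicz_class_convex[of 0 0 0 b "1 / b"] by (simp add: Orlicz_class_corners)
    also have "\<dots> \<le> 1 / b * 1"
      using 1 \<open>\<not> b \<le> 1\<close> by (intro mult_left_mono) auto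
    finally show False using \<open>\<not> b \<le> 1\<close> by (simp add: field_simps)
  qed
qed

lemma Orlicz_gauge_upper:
  assumes "0 < \<mu>" "\<phi> (vector [a / \<mu>, b / \<mu>]) \<le> 1"
  shows "Orlicz_gauge \<phi> a b \<le> \<mu>"
  unfolding Orlicz_gauge_def
  by (rule cInf_lower) (use assms in \<open>auto intro!: bdd_belowI[of _ 0]\<close>)

text \<open>The scaled point lies below the segment from (1, 0) to (0, 1). Raising its second
  coordinate to that segment does not decrease \<open>\<phi>\<close>, and on the segment convexity
  bounds \<open>\<phi>\<close> by its value 1 at the ends.\<close>

lemma Orlicz_class_le_1_if_sum_less:
  assumes "0 \<le> a" "0 \<le> b" "a + b < \<mu>"
  shows "\<phi> (vector [a / \<mu>, b / \<mu>]) \<le> 1"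
proof -
  have \<mu>: "0 < \<mu>" using assms by linarith
  have 1: "\<phi> (vector [a / \<mu>, b / \<mu>]) \<le> \<phi> (vector [a / \<mu>, 1 - a / \<mu>])"
    by (rule Orlicz_class_mono) (use assms \<mu> in \<open>auto simp: field_simps\<close>)
  have 2: "\<phi> (vector [a / \<mu>, 1 - a / \<mu>]) \<le> 1"
    using Orlicz_class_convex[of 0 1 1 0 "a / \<mu>"] assms \<mu>
    by (simp add: Orlicz_class_corners)
  show ?thesis using 1 2 by linarith
qed

text \<open>The set of admissible \<open>\<mu>\<close> contains \<open>a + b + 1\<close>, so its
  \<open>Inf\<close> is a genuine greatest lower bound.\<close>

lemma Orlicz_gauge_greatest:
  assumes "0 \<le> a" "0 \<le> b" "\<And>\<mu>. 0 < \<mu> \<Longrightarrow> \<phi> (vector [a / \<mu>, b / \<mu>]) \<le> 1 \<Longrightarrow> z \<le> \<mu>"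
  shows "z \<le> Orlicz_gauge \<phi> a b"
  unfolding Orlicz_gauge_def
proof (rule cInf_greatest)
  have "a + b + 1 \<in> {\<mu>. 0 < \<mu> \<and> \<phi> (vector [a / \<mu>, b / \<mu>]) \<le> 1}"
    using Orlicz_class_le_1_if_sum_less[of a b "a + b + 1"] assms(1,2) by simp
  then show "{\<mu>. 0 < \<mu> \<and> \<phi> (vector [a / \<mu>, b / \<mu>]) \<le> 1} \<noteq> {}" by blast
qed (use assms in auto)

lemma Orlicz_gauge_lower:
  assumes "0 \<le> a" "0 \<le> b"
  shows "a \<le> Orlicz_gauge \<phi> a b" "b \<le> Orlicz_gauge \<phi> a b"
proof -
  have "a \<le> \<mu> \<and> b \<le> \<mu>" if "0 < \<mu>" "\<phi> (vector [a / \<mu>, b / \<mu>]) \<le> 1" for \<mu>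
    using Orlicz_class_le_1_imp[OF _ _ that(2)] that(1) assms by simp
  then show "a \<le> Orlicz_gauge \<phi> a b" "b \<le> Orlicz_gauge \<phi> a b"
    using assms by (auto intro!: Orlicz_gauge_greatest)
qed

lemma Orlicz_gauge_le_sum:
  assumes "0 \<le> a" "0 \<le> b"
  shows "Orlicz_gauge \<phi> a b \<le> a + b"
proof (rule field_le_epsilon)
  fix e :: real assume "0 < e"
  then show "Orlicz_gauge \<phi> a b \<le> a + b + e"
    using assms by (intro Orlicz_gauge_upper Orlicz_class_le_1_if_sum_less) auto
qed

lemma Orlicz_gauge_scale_le:
  assumes "0 < s" "0 \<le> a" "0 \<le> b"
  shows "s * Orlicz_gauge \<phi> a b \<le> Orlicz_gauge \<phi> (s * a) (s * b)"
proof (rule Orlicz_gauge_greatest)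
  fix \<mu> assume \<mu>: "0 < \<mu>" "\<phi> (vector [s * a / \<mu>, s * b / \<mu>]) \<le> 1"
  have "Orlicz_gauge \<phi> a b \<le> \<mu> / s"
    by (rule Orlicz_gauge_upper) (use \<mu> assms in \<open>auto simp: mult.commute\<close>)
  then show "s * Orlicz_gauge \<phi> a b \<le> \<mu>"
    using assms by (simp add: field_simps)
qed (use assms in auto)

text \<open>The unit set is convex: the sum divided by \<open>\<mu> + \<nu>\<close> is the convex
  combination of the two scaled points with weights proportional to \<open>\<mu>\<close> and
  \<open>\<nu>\<close>.\<close>

lemma Orlicz_gauge_add:
  assumes "0 \<le> a" "0 \<le> b" "0 \<le> c" "0 \<le> d"
  shows "Orlicz_gauge \<phi> (a + c) (b + d) \<le> Orlicz_gauge \<phi> a b + Orlicz_gauge \<phi> c d"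
proof -
  have *: "Orlicz_gauge \<phi> (a + c) (b + d) \<le> \<mu> + \<nu>"
    if \<mu>: "0 < \<mu>" "\<phi> (vector [a / \<mu>, b / \<mu>]) \<le> 1"
    and \<nu>: "0 < \<nu>" "\<phi> (vector [c / \<nu>, d / \<nu>]) \<le> 1" for \<mu> \<nu>
  proof (rule Orlicz_gauge_upper)
    define u where "u = \<nu> / (\<mu> + \<nu>)"
    have u: "0 \<le> u" "u \<le> 1" "1 - u = \<mu> / (\<mu> + \<nu>)"
      using \<mu> \<nu> by (auto simp: u_def field_simps)
    have eq: "(1 - u) * (x / \<mu>) + u * (y / \<nu>) = (x + y) / (\<mu> + \<nu>)" for x y
      using \<mu> \<nu> unfolding u(3) by (simp add: u_def add_divide_distrib)
    have "\<phi> (vector [(a + c) / (\<mu> + \<nu>), (b + d) / (\<mu> + \<nu>)])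
        \<le> (1 - u) * \<phi> (vector [a / \<mu>, b / \<mu>]) + u * \<phi> (vector [c / \<nu>, d / \<nu>])"
      unfolding eq[symmetric] by (rule Orlicz_class_convex) (use assms \<mu> \<nu> u in auto)
    also have "\<dots> \<le> (1 - u) * 1 + u * 1"
      using \<mu> \<nu> u by (intro add_mono mult_left_mono) auto
    finally show "\<phi> (vector [(a + c) / (\<mu> + \<nu>), (b + d) / (\<mu> + \<nu>)]) \<le> 1" by simp
  qed (use \<mu> \<nu> in auto)
  \<comment> \<open>The bound by \<open>\<mu> + \<nu>\<close> is passed to the infimum over
    \<open>\<nu>\<close> for fixed \<open>\<mu>\<close>, then over \<open>\<mu>\<close>.\<close>
  have "Orlicz_gauge \<phi> (a + c) (b + d) - Orlicz_gauge \<phi> c d \<le> Orlicz_gauge \<phi> a b"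
  proof (rule Orlicz_gauge_greatest)
    fix \<mu> assume \<mu>: "0 < \<mu>" "\<phi> (vector [a / \<mu>, b / \<mu>]) \<le> 1"
    have "Orlicz_gauge \<phi> (a + c) (b + d) - \<mu> \<le> Orlicz_gauge \<phi> c d"
      by (rule Orlicz_gauge_greatest) (use assms *[OF \<mu>] in \<open>force simp: algebra_simps\<close>)+
    then show "Orlicz_gauge \<phi> (a + c) (b + d) - Orlicz_gauge \<phi> c d \<le> \<mu>" by simp
  qed (use assms in auto)
  then show ?thesis by simp
qed

lemma monotone_gauge_Orlicz_gauge: "monotone_gauge (Orlicz_gauge \<phi>)"
proof
  fix a b s :: real assume "0 < s" "0 \<le> a" "0 \<le> b"
  \<comment> \<open>The reverse inequality is the same estimate with factor \<open>1 / s\<close> at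
    the scaled point.\<close>
  moreover from this have "Orlicz_gauge \<phi> (s * a) (s * b) \<le> s * Orlicz_gauge \<phi> a b"
    using Orlicz_gauge_scale_le[of "1 / s" "s * a" "s * b"] by (simp add: field_simps)
  ultimately show "Orlicz_gauge \<phi> (s * a) (s * b) = s * Orlicz_gauge \<phi> a b"
    by (intro antisym Orlicz_gauge_scale_le)
next
  fix a b c d :: real assume *: "0 \<le> a" "0 \<le> b" "a \<le> c" "b \<le> d"
  show "Orlicz_gauge \<phi> a b \<le> Orlicz_gauge \<phi> c d"
  proof (rule Orlicz_gauge_greatest)
    fix \<mu> assume \<mu>: "0 < \<mu>" "\<phi> (vector [c / \<mu>, d / \<mu>]) \<le> 1"
    have "\<phi> (vector [a / \<mu>, b / \<mu>]) \<le> \<phi> (vector [c / \<mu>, d / \<mu>])"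
      using * \<mu>(1) by (intro Orlicz_class_mono divide_right_mono) auto
    then show "Orlicz_gauge \<phi> a b \<le> \<mu>"
      using \<mu> by (intro Orlicz_gauge_upper) auto
  qed (use * in auto)
next
  fix a :: real assume "0 \<le> a"
  then show "Orlicz_gauge \<phi> a 0 = a" "Orlicz_gauge \<phi> 0 a = a"
    using Orlicz_gauge_lower[of a 0] Orlicz_gauge_le_sum[of a 0]
      Orlicz_gauge_lower[of 0 a] Orlicz_gauge_le_sum[of 0 a] by auto
qed (rule Orlicz_gauge_add)

text \<open>By homogeneity the gauge of (a |x|, b |x|) is |x| times that of (a, b), which is the
  support function of a ball. Sums of balls thus reveal every value of the gauge.\<close>

lemma Orlicz_sum_cball:
  assumes "0 \<le> a" "0 \<le> b"
  shows "Orlicz_sum \<phi> (cball 0 a) (cball 0 b) = cball 0 (Orlicz_gauge \<phi> a b)"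
proof -
  interpret g: monotone_gauge "Orlicz_gauge \<phi>" by (rule monotone_gauge_Orlicz_gauge)
  have nonneg: "0 \<le> Orlicz_gauge \<phi> a b"
    using Orlicz_gauge_lower[OF assms] assms by linarith
  have support: "Orlicz_sum_support \<phi> (cball 0 a) (cball 0 b) x
      = support_function (cball 0 (Orlicz_gauge \<phi> a b)) x" for x
  \<comment> \<open>Homogeneity is available for positive factors, so the factor
    \<open>norm x = 0\<close> is treated apart.\<close>
  proof (cases "x = 0")
    case True
    then show ?thesis
      using assms nonneg g.left[of 0] by (simp add: Orlicz_sum_support_eq_gauge support_function_cball)
  next
    case False
    then show ?thesis
      using assms nonneg g.scale[of "norm x" a b]
      by (simp add: Orlicz_sum_support_eq_gauge support_function_cball mult.commute)
  qed
  show ?thesis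
    unfolding Orlicz_sum_def support
  proof (rule the_equality)
    fix M :: "(real ^ 'a) set"
    assume "compact M \<and> convex M \<and> M \<noteq> {} \<and>
      (\<forall>x. support_function M x = support_function (cball 0 (Orlicz_gauge \<phi> a b)) x)"
    then show "M = cball 0 (Orlicz_gauge \<phi> a b)"
      using nonneg by (intro antisym subset_of_support_function_le) auto
  qed (use nonneg in auto)
qed

end

section \<open>Representing a symmetric gauge\<close>

text \<open>The line lies below the glued function on the whole half-line and agrees with it from
  \<open>t\<close> on. Hence chords lie above the function at points beyond \<open>t\<close>, and
  only chords that cross \<open>t\<close> and are tested to its left need more than the convexity of
  \<open>h\<close>.\<close>

lemma convex_on_glue_affine:
  fixes h :: "real \<Rightarrow> real"
  assumes h: "convex_on {0..t} h"
    and above: "\<And>x. x \<in> {0..t} \<Longrightarrow> k + c * x \<le> h x"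
    and touch: "h t = k + c * t"
  shows "convex_on {0..} (\<lambda>x. if x \<le> t then h x else k + c * x)" (is "convex_on _ ?H")
proof (rule convex_on_linorderI)
  fix u x y :: real
  assume u: "0 < u" "u < 1" and xy: "x \<in> {0..}" "y \<in> {0..}" "x < y"
  define z where "z = (1 - u) * x + u * y"
  have H_ge: "k + c * w \<le> ?H w" if "0 \<le> w" for w
    using above that by auto
  have z_eq: "z = x + u * (y - x)" "y = z + (1 - u) * (y - x)"
    by (simp_all add: z_def algebra_simps)
  have "0 < u * (y - x)" "0 < (1 - u) * (y - x)"
    using u xy(3) by simp_all
  with z_eq have "x < z" "z < y"
    by (metis less_add_same_cancel1)+
  have "?H z \<le> (1 - u) * ?H x + u * ?H y"
  proof (cases "t \<le> z")
    case True
    then have "?H z = k + c * z"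
      using touch by auto
    also have "\<dots> = (1 - u) * (k + c * x) + u * (k + c * y)"
      by (simp add: z_def algebra_simps)
    also have "\<dots> \<le> (1 - u) * ?H x + u * ?H y"
      using u xy by (intro add_mono mult_left_mono H_ge) auto
    finally show ?thesis .
  next
    case False
    show ?thesis
    proof (cases "y \<le> t")
      case True
      then show ?thesis
        using convex_onD[OF h, of u x y] u xy \<open>z < y\<close> by (simp add: z_def)
    next
      case y: False
      \<comment> \<open>Here x < z < t < y. The weight of \<open>y\<close> in \<open>t\<close> is
        \<open>v\<close>, and \<open>q = u / v\<close> is the weight of \<open>t\<close> when
        \<open>z\<close> is written as a combination of \<open>x\<close> and \<open>t\<close>. Then
        \<open>h t\<close> is expanded along the line, whose value at \<open>x\<close> is at most
        \<open>h x\<close>.\<close>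
      define v where "v = (t - x) / (y - x)"
      have t: "t = (1 - v) * x + v * y"
      proof -
        have "v * (y - x) = t - x" using xy(3) by (simp add: v_def)
        then show ?thesis by (simp add: algebra_simps)
      qed
      have v: "u < v" "v < 1"
        using \<open>\<not> t \<le> z\<close> y xy(3) z_eq(1) by (simp_all add: v_def less_divide_eq)
      define q where "q = u / v"
      have q: "0 \<le> q" "q \<le> 1" and qv: "q * v = u"
        using u v by (simp_all add: q_def)
      have combine: "(1 - q) * w + q * ((1 - v) * w + v * w') = (1 - u) * w + u * w'" for w w'
        unfolding qv[symmetric] by (simp add: algebra_simps)
      have z: "(1 - q) * x + q * t = z"
        using combine[of x y] t by (simp add: z_def)
      have "h z \<le> (1 - q) * h x + q * h t"
        using convex_onD[OF h q, of x t] xy \<open>x < z\<close> \<open>\<not> t \<le> z\<close> by (simp add: z)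
      also have "h t = (1 - v) * (k + c * x) + v * (k + c * y)"
        unfolding touch by (subst t) (simp add: algebra_simps)
      also have "(1 - q) * h x + q * \<dots> \<le> (1 - q) * h x + q * ((1 - v) * h x + v * (k + c * y))"
        using above[of x] q v xy \<open>x < z\<close> \<open>\<not> t \<le> z\<close>
        by (intro add_left_mono mult_left_mono add_right_mono) auto
      also have "\<dots> = (1 - u) * h x + u * (k + c * y)"
        by (rule combine)
      finally show ?thesis
        using y \<open>x < z\<close> \<open>\<not> t \<le> z\<close> by simp
    qed
  qed
  then show "?H ((1 - u) *\<^sub>R x + u *\<^sub>R y) \<le> (1 - u) * ?H x + u * ?H y"
    by (simp only: z_def real_scaleR_def)
qed simp

section \<open>Membership of the candidate functions in the Orlicz classes\<close>

lemma Orlicz_class_1I: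
  assumes "convex_on {0..} \<phi>" "\<And>x y. 0 \<le> x \<Longrightarrow> x \<le> y \<Longrightarrow> \<phi> x \<le> \<phi> y" "\<phi> 0 = 0" "\<phi> 1 = 1"
  shows "\<phi> \<in> Orlicz_class_1"
proof -
  have "convex_on nonneg_orthant (\<lambda>x :: real ^ 1. \<phi> (x $ 1))"
    using convex_onD[OF assms(1)]
    by (intro convex_onI convex_nonneg_orthant) (auto simp: nonneg_orthant_def)
  moreover have "0 \<le> \<phi> x" if "0 \<le> x" for x
    using assms(2)[of 0 x] assms(3) that by simp
  ultimately show ?thesis
    using assms by (auto simp: Orlicz_class_1_def Orlicz_class_def nonneg_orthant_def axis_def forall_1)
qed

lemma equal_sum_in_Orlicz_class:
  assumes "convex_on {0..} \<phi>" "\<And>x y. 0 \<le> x \<Longrightarrow> x \<le> y \<Longrightarrow> \<phi> x \<le> \<phi> y" "\<phi> 0 = 0" "\<phi> 1 = 1"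
  shows "(\<lambda>x :: real ^ 2. \<phi> (x $ 1) + \<phi> (x $ 2)) \<in> Orlicz_class"
proof -
  have "convex_on nonneg_orthant (\<lambda>x :: real ^ 2. \<phi> (x $ i))" for i
    using convex_onD[OF assms(1)]
    by (intro convex_onI convex_nonneg_orthant) (auto simp: nonneg_orthant_def)
  then have "convex_on nonneg_orthant (\<lambda>x :: real ^ 2. \<phi> (x $ 1) + \<phi> (x $ 2))"
    by (intro convex_on_add)
  moreover have "0 \<le> \<phi> x" if "0 \<le> x" for x
    using assms(2)[of 0 x] assms(3) that by simp
  ultimately show ?thesis
    using assms by (auto simp: Orlicz_class_def nonneg_orthant_def axis_def forall_2)
qed

lemma max_in_Orlicz_class: "(\<lambda>x :: real ^ 2. max (x $ 1) (x $ 2)) \<in> Orlicz_class"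
proof -
  have "convex_on nonneg_orthant (\<lambda>x :: real ^ 2. max (x $ 1) (x $ 2))"
  proof (rule convex_onI)
    fix u :: real and x y :: "real ^ 2" assume u: "0 < u" "u < 1"
    have "(1 - u) * x $ i + u * y $ i \<le> (1 - u) * max (x $ 1) (x $ 2) + u * max (y $ 1) (y $ 2)"
      if "i = 1 \<or> i = 2" for i
      using u that by (intro add_mono mult_left_mono) auto
    then show "max (((1 - u) *\<^sub>R x + u *\<^sub>R y) $ 1) (((1 - u) *\<^sub>R x + u *\<^sub>R y) $ 2)
        \<le> (1 - u) * max (x $ 1) (x $ 2) + u * max (y $ 1) (y $ 2)"
      by simp
  qed (rule convex_nonneg_orthant)
  then show ?thesis
    by (auto simp: Orlicz_class_def nonneg_orthant_def axis_def forall_2)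
qed

section \<open>Symmetric gauges: the diagonal point and the boundary curve\<close>

locale symmetric_gauge = monotone_gauge +
  assumes sym: "\<And>a b. 0 \<le> a \<Longrightarrow> 0 \<le> b \<Longrightarrow> g a b = g b a"
begin

lemma max_le: "0 \<le> a \<Longrightarrow> 0 \<le> b \<Longrightarrow> max a b \<le> g a b"
  using mono[of a 0 a b] mono[of 0 b a b] left[of a] right[of b] by auto

text \<open>A homogeneous gauge is determined by its unit set, so \<open>\<psi>\<close> has to match
  \<open>g\<close> only in the sublevel set at 1.\<close>

lemma Orlicz_gauge_eqI:
  assumes "\<And>x y. 0 \<le> x \<Longrightarrow> 0 \<le> y \<Longrightarrow> \<psi> (vector [x, y]) \<le> 1 \<longleftrightarrow> g x y \<le> 1"
    and "0 \<le> a" "0 \<le> b"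
  shows "Orlicz_gauge \<psi> a b = g a b"
proof -
  have "\<psi> (vector [a / \<mu>, b / \<mu>]) \<le> 1 \<longleftrightarrow> g a b \<le> \<mu>" if "0 < \<mu>" for \<mu>
  proof -
    have "g (a / \<mu>) (b / \<mu>) = g a b / \<mu>"
      using scale[of "1 / \<mu>" a b] assms that by simp
    then show ?thesis using assms that by simp
  qed
  then have eq: "{\<mu>. 0 < \<mu> \<and> \<psi> (vector [a / \<mu>, b / \<mu>]) \<le> 1} = {\<mu>. 0 < \<mu> \<and> g a b \<le> \<mu>}"
    by auto
  have nonneg: "0 \<le> g a b" using max_le[of a b] assms by simp
  show ?thesis
  proof (rule antisym)
    show "Orlicz_gauge \<psi> a b \<le> g a b"
    \<comment> \<open>At the origin \<open>g a b\<close> is 0 and not an admissible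
      \<open>\<mu>\<close>; \<open>g a b + e\<close> always is.\<close>
    proof (rule field_le_epsilon)
      fix e :: real assume "0 < e"
      then show "Orlicz_gauge \<psi> a b \<le> g a b + e"
        unfolding Orlicz_gauge_def eq using nonneg by (intro cInf_lower) (auto intro!: bdd_belowI[of _ 0])
    qed
    have "g a b + 1 \<in> {\<mu>. 0 < \<mu> \<and> g a b \<le> \<mu>}" using nonneg by simp
    then show "g a b \<le> Orlicz_gauge \<psi> a b"
      unfolding Orlicz_gauge_def eq by (intro cInf_greatest) auto
  qed
qed

text \<open>By homogeneity the ray through (1, 1) leaves the unit set of \<open>g\<close> at
  (\<open>diag\<close>, \<open>diag\<close>).\<close>

definition diag :: real where "diag = 1 / g 1 1"

lemma g_1_1_bounds: "1 \<le> g 1 1" "g 1 1 \<le> 2"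
  using max_le[of 1 1] add[of 1 0 0 1] left[of 1] right[of 1] by auto

lemma diag_pos: "0 < diag" and diag_le: "diag \<le> 1"
  using g_1_1_bounds by (auto simp: diag_def)

lemma g_diagonal_le_iff:
  assumes "0 \<le> x"
  shows "g x x \<le> 1 \<longleftrightarrow> x \<le> diag"
proof (cases "x = 0")
  case True
  then show ?thesis using left[of 0] diag_pos by simp
next
  case False
  then show ?thesis
    using scale[of x 1 1] assms g_1_1_bounds by (simp add: diag_def field_simps)
qed

text \<open>Averaging (x, y) with its mirror image (y, x) gives a diagonal point of the unit set. So
  symmetry makes x + y = 2 \<open>diag\<close> a supporting line of the unit set at the diagonal
  point.\<close>

lemma sum_le_diag:
  assumes "0 \<le> x" "0 \<le> y" "g x y \<le> 1"
  shows "x + y \<le> 2 * diag"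
proof -
  have "g (x + y) (y + x) \<le> 2"
    using add[of x y y x] sym[of x y] assms by simp
  then have "g ((x + y) / 2) ((x + y) / 2) \<le> 1"
    using scale[of "1 / 2" "x + y" "x + y"] assms by (simp add: add.commute)
  then show ?thesis
    using g_diagonal_le_iff[of "(x + y) / 2"] assms by simp
qed

definition curve :: "real \<Rightarrow> real" where "curve x = Sup {y. 0 \<le> y \<and> g x y \<le> 1}"

text \<open>The supremum defining \<open>curve x\<close> is attained: by subadditivity and
  \<open>g 0 e = e\<close>, moving up by \<open>e\<close> raises \<open>g\<close> by at most
  \<open>e\<close>.\<close>

lemma le_curve_iff:
  assumes "0 \<le> x" "x \<le> 1" "0 \<le> y"
  shows "y \<le> curve x \<longleftrightarrow> g x y \<le> 1"
proof
  let ?S = "{y. 0 \<le> y \<and> g x y \<le> 1}"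
  have ne: "?S \<noteq> {}" using left[of x] assms by (intro ex_in_conv[THEN iffD1] exI[of _ 0]) simp
  have bdd: "bdd_above ?S"
    using max_le[OF assms(1)] by (intro bdd_aboveI[of _ 1]) force
  show "y \<le> curve x" if "g x y \<le> 1"
    unfolding curve_def using bdd that assms by (intro cSup_upper) auto
  show "g x y \<le> 1" if "y \<le> curve x"
  proof (rule field_le_epsilon)
    fix e :: real assume "0 < e"
    then have "y - e < Sup ?S" using that by (simp add: curve_def)
    then obtain w where w: "0 \<le> w" "g x w \<le> 1" "y - e < w"
      using less_cSup_iff[OF ne bdd] by auto
    have "g x y \<le> g (x + 0) (w + e)"
      using assms w by (intro mono) auto
    also have "\<dots> \<le> g x w + g 0 e"
      using assms w \<open>0 < e\<close> by (intro add) auto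
    finally show "g x y \<le> 1 + e"
      using w right[of e] \<open>0 < e\<close> by simp
  qed
qed

lemma curve_nonneg: "0 \<le> x \<Longrightarrow> x \<le> 1 \<Longrightarrow> 0 \<le> curve x"
  using le_curve_iff[of x 0] left[of x] by simp

lemma g_curve_le: "0 \<le> x \<Longrightarrow> x \<le> 1 \<Longrightarrow> g x (curve x) \<le> 1"
  using le_curve_iff[of x "curve x"] curve_nonneg by simp

lemma curve_0: "curve 0 = 1"
proof (rule antisym)
  show "1 \<le> curve 0" using le_curve_iff[of 0 1] right[of 1] by simp
  show "curve 0 \<le> 1" using g_curve_le[of 0] right[of "curve 0"] curve_nonneg[of 0] by simp
qed

lemma curve_antimono:
  assumes "0 \<le> x" "x \<le> y" "y \<le> 1"
  shows "curve y \<le> curve x"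
proof -
  have "g x (curve y) \<le> g y (curve y)"
    using assms curve_nonneg by (intro mono) auto
  also have "\<dots> \<le> 1" using assms by (intro g_curve_le) auto
  finally show ?thesis using le_curve_iff[of x "curve y"] assms curve_nonneg by simp
qed

lemma curve_add_le: "0 \<le> x \<Longrightarrow> x \<le> 1 \<Longrightarrow> curve x + x \<le> 2 * diag"
  using sum_le_diag[of x "curve x"] curve_nonneg g_curve_le by simp

lemma curve_diag: "curve diag = diag"
proof (rule antisym)
  show "curve diag \<le> diag"
    using curve_add_le[of diag] diag_pos diag_le by simp
  show "diag \<le> curve diag"
    using le_curve_iff[of diag diag] g_diagonal_le_iff[of diag] diag_pos diag_le by simp
qed

text \<open>The curve is the upper boundary of the unit set, which is convex because
  \<open>g\<close> is subadditive and homogeneous.\<close>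

lemma concave_curve:
  assumes "0 \<le> x" "x \<le> 1" "0 \<le> y" "y \<le> 1" "0 < u" "u < 1"
  shows "(1 - u) * curve x + u * curve y \<le> curve ((1 - u) * x + u * y)"
proof -
  have "g ((1 - u) * x + u * y) ((1 - u) * curve x + u * curve y)
      \<le> g ((1 - u) * x) ((1 - u) * curve x) + g (u * y) (u * curve y)"
    using assms curve_nonneg by (intro add) auto
  also have "\<dots> = (1 - u) * g x (curve x) + u * g y (curve y)"
    using assms curve_nonneg by (simp add: scale)
  also have "\<dots> \<le> (1 - u) * 1 + u * 1"
    using assms by (intro add_mono mult_left_mono g_curve_le) auto
  finally have "g ((1 - u) * x + u * y) ((1 - u) * curve x + u * curve y) \<le> 1" by simp
  moreover have "(1 - u) * x + u * y \<le> 1"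
    using convex_bound_le[of x 1 y "1 - u" u] assms by simp
  ultimately show ?thesis
    using assms curve_nonneg by (subst le_curve_iff) auto
qed

section \<open>The one-variable summand\<close>

definition slope :: real where "slope = 1 / (2 * (1 - diag))"

text \<open>The right branch is the line through (\<open>diag\<close>, 1/2) and (1, 1), with slope
  \<open>slope\<close>. The same factor makes the left branch reach 1/2 at \<open>diag\<close>,
  where \<open>curve\<close> equals \<open>diag\<close>.\<close>

definition summand :: "real \<Rightarrow> real" where
  "summand x = (if x \<le> diag then slope * (1 - curve x) else (1 - slope) + slope * x)"

context
  assumes diag_less: "diag < 1"
begin

lemma slope_pos: "0 < slope" and slope_diag: "slope * diag = slope - 1 / 2"
  using diag_less by (auto simp: slope_def field_simps)

lemma summand_diag: "summand diag = 1 / 2"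
  by (simp add: summand_def curve_diag slope_diag right_diff_distrib)

text \<open>The left branch is convex since \<open>curve\<close> is concave. It stays above the line
  of the right branch because \<open>curve x + x \<le> 2 * diag\<close>, which is where the symmetry
  of \<open>g\<close> enters.\<close>

lemma convex_summand: "convex_on {0..} summand"
  unfolding summand_def
proof (rule convex_on_glue_affine)
  show "convex_on {0..diag} (\<lambda>x. slope * (1 - curve x))"
  proof (rule convex_onI)
    fix u x y :: real assume "0 < u" "u < 1" "x \<in> {0..diag}" "y \<in> {0..diag}"
    then have "slope * ((1 - u) * curve x + u * curve y) \<le> slope * curve ((1 - u) * x + u * y)"
      using slope_pos diag_le by (intro mult_left_mono concave_curve) auto
    then show "slope * (1 - curve ((1 - u) *\<^sub>R x + u *\<^sub>R y))
        \<le> (1 - u) * (slope * (1 - curve x)) + u * (slope * (1 - curve y))"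
      by (simp add: algebra_simps)
  qed simp
  show "1 - slope + slope * x \<le> slope * (1 - curve x)" if "x \<in> {0..diag}" for x
  proof -
    have "slope * (curve x + x) \<le> slope * (2 * diag)"
      using curve_add_le[of x] that diag_le slope_pos by (intro mult_left_mono) auto
    then show ?thesis using slope_diag by (simp add: algebra_simps)
  qed
  show "slope * (1 - curve diag) = 1 - slope + slope * diag"
    using slope_diag by (simp add: curve_diag algebra_simps)
qed

lemma summand_mono_below:
  assumes "0 \<le> x" "x \<le> y" "y \<le> diag"
  shows "summand x \<le> summand y"
  using assms curve_antimono[of x y] slope_pos diag_less
  by (auto simp: summand_def intro!: mult_left_mono)

lemma summand_above:
  assumes "diag < x"
  shows "1 / 2 < summand x"
  using assms mult_strict_left_mono[OF assms slope_pos] slope_diag by (simp add: summand_def)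

lemma summand_mono:
  assumes "0 \<le> x" "x \<le> y"
  shows "summand x \<le> summand y"
proof (cases "y \<le> diag")
  case True
  then show ?thesis using summand_mono_below assms by simp
next
  case False
  show ?thesis
  proof (cases "x \<le> diag")
    case True
    then show ?thesis
      using summand_mono_below[of x diag] assms summand_diag summand_above[of y] False by simp
  next
    case False
    then show ?thesis
      using assms slope_pos by (auto simp: summand_def intro!: mult_left_mono)
  qed
qed

lemma summand_0: "summand 0 = 0"
  using diag_pos by (simp add: summand_def curve_0)

lemma summand_1: "summand 1 = 1"
  using diag_less by (simp add: summand_def)

text \<open>If both arguments are at most \<open>diag\<close>, both sides hold; if both exceed it,
  both fail. Otherwise the two branches combine so that the sum exceeds 1 exactly when the larger
  argument lies above the curve over the smaller one.\<close>

lemma summand_sum_le_iff: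
  assumes "0 \<le> x" "0 \<le> y"
  shows "summand x + summand y \<le> 1 \<longleftrightarrow> g x y \<le> 1"
proof -
  \<comment> \<open>Both sides are symmetric, so the arguments may be ordered.\<close>
  have *: "summand x + summand y \<le> 1 \<longleftrightarrow> g x y \<le> 1" if xy: "0 \<le> x" "x \<le> y" for x y
  proof -
    consider "y \<le> diag" | "diag < x" | "x \<le> diag" "diag < y" by linarith
    then show ?thesis
    proof cases
      case 1
      then have "summand x \<le> 1 / 2" "summand y \<le> 1 / 2"
        using summand_mono[of x diag] summand_mono[of y diag] summand_diag xy by auto
      moreover have "g x y \<le> g y y" "g y y \<le> 1"
        using 1 xy by (auto simp: g_diagonal_le_iff intro: mono)
      ultimately show ?thesis by simp
    next
      case 2
      then have "1 / 2 < summand x" "1 / 2 < summand y"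
        using summand_above xy by auto
      moreover have "g x x \<le> g x y" "\<not> g x x \<le> 1"
        using 2 xy by (auto simp: g_diagonal_le_iff intro: mono)
      ultimately show ?thesis by simp
    next
      case 3
      then have "summand x + summand y = 1 + slope * (y - curve x)"
        by (simp add: summand_def algebra_simps)
      then have "summand x + summand y \<le> 1 \<longleftrightarrow> y \<le> curve x"
        using slope_pos by (simp add: mult_le_0_iff)
      then show ?thesis
        using le_curve_iff[of x y] 3 xy diag_le by simp
    qed
  qed
  show ?thesis
    using *[of x y] *[of y x] sym assms by (cases "x \<le> y") (auto simp: add.commute)
qed

end

text \<open>When (1, 1) lies in the unit set, monotonicity puts the whole unit square there, and the
  square always contains the unit set.\<close>

lemma max_le_1_iff_if_diag_1:
  assumes "diag = 1" "0 \<le> x" "0 \<le> y"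
  shows "max x y \<le> 1 \<longleftrightarrow> g x y \<le> 1"
proof
  assume "max x y \<le> 1"
  then show "g x y \<le> 1"
    using mono[of x y 1 1] g_diagonal_le_iff[of 1] assms by simp
qed (use max_le[of x y] assms in auto)

lemma exists_max_or_equal_sum:
  "\<exists>\<psi>\<in>Orlicz_class. max_or_equal_sum \<psi> \<and> (\<forall>a\<ge>0. \<forall>b\<ge>0. Orlicz_gauge \<psi> a b = g a b)"
\<comment> \<open>The case \<open>diag = 1\<close> is split off because \<open>slope\<close> divides
  by \<open>1 - diag\<close>.\<close>
proof (cases "diag = 1")
  case True
  then have "\<forall>a\<ge>0. \<forall>b\<ge>0. Orlicz_gauge (\<lambda>x. max (x $ 1) (x $ 2)) a b = g a b"
    using max_le_1_iff_if_diag_1 by (auto intro!: Orlicz_gauge_eqI)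
  then show ?thesis
    using max_in_Orlicz_class by (force simp: max_or_equal_sum_def)
next
  case False
  then have less: "diag < 1" using diag_le by simp
  note summand = convex_summand[OF less] summand_mono[OF less] summand_0[OF less] summand_1[OF less]
  have gauge: "\<forall>a\<ge>0. \<forall>b\<ge>0. Orlicz_gauge (\<lambda>x. summand (x $ 1) + summand (x $ 2)) a b = g a b"
    using summand_sum_le_iff[OF less] by (auto intro!: Orlicz_gauge_eqI)
  have "summand \<in> Orlicz_class_1"
    by (rule Orlicz_class_1I) (fact summand)+
  then have "max_or_equal_sum (\<lambda>x. summand (x $ 1) + summand (x $ 2))"
    unfolding max_or_equal_sum_def by (intro disjI2 bexI[of _ summand]) auto
  moreover have "(\<lambda>x :: real ^ 2. summand (x $ 1) + summand (x $ 2)) \<in> Orlicz_class"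
    by (rule equal_sum_in_Orlicz_class) (fact summand)+
  ultimately show ?thesis
    by (intro bexI[of _ "\<lambda>x. summand (x $ 1) + summand (x $ 2)"] conjI gauge)
qed

end

section \<open>Commutativity\<close>

text \<open>Balls in \<open>C\<close> turn commutativity of the sum into symmetry of the gauge, and
  the origin in each member lets gauge identities pass back to sums. Both classes of the theorem
  have these two properties.\<close>

lemma commutative_Orlicz_sum_iff:
  fixes C :: "(real ^ 'n) set set"
  assumes \<phi>: "\<phi> \<in> Orlicz_class"
    and C: "C \<subseteq> compact_convex_with_origin" "\<And>r. 0 \<le> r \<Longrightarrow> cball 0 r \<in> C"
  shows "commutative_op_on C (Orlicz_sum \<phi>) \<longleftrightarrow>
    (\<exists>\<psi>\<in>Orlicz_class. max_or_equal_sum \<psi> \<and>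
      (\<forall>K\<in>C. \<forall>L\<in>C. Orlicz_sum \<phi> K L = Orlicz_sum \<psi> K L))"
proof
  assume comm: "commutative_op_on C (Orlicz_sum \<phi>)"
  interpret monotone_gauge "Orlicz_gauge \<phi>"
    by (rule monotone_gauge_Orlicz_gauge[OF \<phi>])
  interpret symmetric_gauge "Orlicz_gauge \<phi>"
  proof
    fix a b :: real assume ab: "0 \<le> a" "0 \<le> b"
    then have "Orlicz_sum \<phi> (cball 0 a) (cball 0 b :: (real ^ 'n) set) = Orlicz_sum \<phi> (cball 0 b) (cball 0 a)"
      using comm C(2) by (simp add: commutative_op_on_def)
    then have "cball (0 :: real ^ 'n) (Orlicz_gauge \<phi> a b) = cball 0 (Orlicz_gauge \<phi> b a)"
      using ab by (simp add: Orlicz_sum_cball[OF \<phi>])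
    \<comment> \<open>Balls of negative radius are all empty, so equal balls give equal radii once
      both are known to be nonnegative.\<close>
    moreover have "0 \<le> Orlicz_gauge \<phi> a b" "0 \<le> Orlicz_gauge \<phi> b a"
      using Orlicz_gauge_lower[OF \<phi> ab] Orlicz_gauge_lower[OF \<phi> ab(2,1)] ab by linarith+
    ultimately show "Orlicz_gauge \<phi> a b = Orlicz_gauge \<phi> b a"
      by (simp add: cball_eq_cball_iff)
  qed
  obtain \<psi> where \<psi>: "\<psi> \<in> Orlicz_class" "max_or_equal_sum \<psi>"
    "\<forall>a\<ge>0. \<forall>b\<ge>0. Orlicz_gauge \<psi> a b = Orlicz_gauge \<phi> a b"
    using exists_max_or_equal_sum by blast
  have "Orlicz_sum \<phi> K L = Orlicz_sum \<psi> K L" if "K \<in> C" "L \<in> C" for K L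
    using that C(1) \<psi>(3) by (intro Orlicz_sum_cong) auto
  then show "\<exists>\<psi>\<in>Orlicz_class. max_or_equal_sum \<psi> \<and>
      (\<forall>K\<in>C. \<forall>L\<in>C. Orlicz_sum \<phi> K L = Orlicz_sum \<psi> K L)"
    using \<psi>(1,2) by blast
next
  assume "\<exists>\<psi>\<in>Orlicz_class. max_or_equal_sum \<psi> \<and>
      (\<forall>K\<in>C. \<forall>L\<in>C. Orlicz_sum \<phi> K L = Orlicz_sum \<psi> K L)"
  then obtain \<psi> where \<psi>: "max_or_equal_sum \<psi>" "\<And>K L. K \<in> C \<Longrightarrow> L \<in> C \<Longrightarrow> Orlicz_sum \<phi> K L = Orlicz_sum \<psi> K L"
    by blast
  have "Orlicz_sum \<psi> K L = Orlicz_sum \<psi> L K" if "K \<in> C" "L \<in> C" for K L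
    using that C(1) max_or_equal_sum_gauge_commute[OF \<psi>(1)] by (intro Orlicz_sum_commute) auto
  then show "commutative_op_on C (Orlicz_sum \<phi>)"
    using \<psi>(2) by (simp add: commutative_op_on_def)
qed

theorem theorem5p9:
  fixes \<phi> :: "real ^ 2 \<Rightarrow> real"
  assumes "CARD('n::finite) \<ge> 2"
    and "\<phi> \<in> Orlicz_class"
  shows "(commutative_op_on (compact_convex_symmetric :: (real ^ 'n) set set) (Orlicz_sum \<phi>) \<longleftrightarrow>
      (\<exists>\<psi>\<in>Orlicz_class. max_or_equal_sum \<psi> \<and>
        (\<forall>K\<in>(compact_convex_symmetric :: (real ^ 'n) set set). \<forall>L\<in>compact_convex_symmetric.
          Orlicz_sum \<phi> K L = Orlicz_sum \<psi> K L)))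
    \<and> (commutative_op_on (compact_convex_with_origin :: (real ^ 'n) set set) (Orlicz_sum \<phi>) \<longleftrightarrow>
      (\<exists>\<psi>\<in>Orlicz_class. max_or_equal_sum \<psi> \<and>
        (\<forall>K\<in>(compact_convex_with_origin :: (real ^ 'n) set set). \<forall>L\<in>compact_convex_with_origin.
          Orlicz_sum \<phi> K L = Orlicz_sum \<psi> K L)))"
  by (intro conjI commutative_Orlicz_sum_iff[OF assms(2)] compact_convex_symmetric_subset order_refl
      cball_in_compact_convex_symmetric cball_in_compact_convex_symmetric[THEN subsetD[OF compact_convex_symmetric_subset]])

end
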